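(* Let $G$ be a finite group in $\mathfrak{Y}_n$. Then $G$ is either soluble or simple.
   Context: $\mathfrak{Y}_n$ denotes the class of all groups $G$ such that $N_G(A)=A$ for every non-abelian subgroup $A\le G$. *)

theory Defs
  imports "HOL-Algebra.Algebra"
begin

definition Y_n_group :: "('a, 'b) monoid_scheme \<Rightarrow> bool" where
  "Y_n_group G \<longleftrightarrow> group G \<and>
     (\<forall>A. subgroup A G \<and> \<not> (\<forall>x\<in>A. \<forall>y\<in>A. x \<otimes>\<^bsub>G\<^esub> y = y \<otimes>\<^bsub>G\<^esub> x)
          \<longrightarrow> normalizer G A = A)"

end

theory Submission
  imports Defs
begin

text \<open>
  Suppose G is neither soluble nor simple. A proper normal subgroup is not self-normalizing, hence
  abelian; so G is perfect and has a nontrivial abelian normal subgroup K. Let N be the centralizer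
  of K.

  If N is proper, then every subgroup of G properly containing N is non-abelian, so all nontrivial
  subgroups of the perfect group G/N are self-normalizing. As normalizers grow in p-groups, a Sylow
  subgroup P of G/N is generated by each of its nontrivial elements, so two elements of P conjugate
  in G/N are equal, and the transfer into P gives a contradiction.

  If K is central, take z in K of prime order p and a Sylow p-subgroup P containing z. The transfer
  into P/P' kills z, so z lies in P' and P is a self-normalizing minimal non-abelian p-group, which
  forces P' to be generated by z. By a Sylow argument modulo this central subgroup, elements of P
  conjugate in G agree modulo P', so the transfer shows P = P', which is absurd.
\<close>

subsection \<open>Fixed points of p-group actions\<close>

text \<open>Orbit sizes divide \<open>p ^ k\<close>, so an orbit without a fixed point has size
  divisible by \<open>p\<close>, while a fixed point is an orbit by itself. Summing over the orbits
  gives the congruence.\<close>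

lemma (in group_action) p_group_fixed_points:
  assumes p: "Factorial_Ring.prime p" and ord: "order G = p ^ k" and fin: "finite E"
  shows "card {x \<in> E. \<forall>g\<in>carrier G. \<phi> g x = x} mod p = card E mod p"
proof -
  define F where "F = {x \<in> E. \<forall>g\<in>carrier G. \<phi> g x = x}"
  \<comment> \<open>The sum counts the fixed points in the orbit \<open>C\<close>, so the congruence
    is first proved one orbit at a time.\<close>
  have orb: "(\<Sum>x\<in>C. if x \<in> F then 1 else 0) mod p = card C mod p"
    if C: "C \<in> orbits G E \<phi>" for C
  proof (cases "C \<inter> F = {}")
    case True
    obtain x where x: "x \<in> E" "C = orbit G \<phi> x"
      using C by (auto simp: orbits_def)
    have "card C dvd p ^ k"
      using orbit_stabilizer_theorem[OF x(1)] x(2) ord by (metis dvd_triv_left)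
    then obtain j where j: "card C = p ^ j"
      using p by (auto simp: divides_primepow_nat)
    have "j \<noteq> 0"
    proof
      assume "j = 0"
      then have "card C = 1" using j by simp
      moreover have xC: "x \<in> C" using orbit_refl[OF x(1)] x(2) by simp
      ultimately have "C = {x}" by (metis card_1_singletonE singletonD)
      then have "x \<in> F" using x unfolding F_def orbit_def by auto
      then show False using xC True by blast
    qed
    then have "p dvd card C" using j by simp
    moreover have "(\<Sum>x\<in>C. if x \<in> F then 1 else 0) = (0::nat)"
      using True by (intro sum.neutral) auto
    ultimately show ?thesis by simp
  next
    case False
    then obtain x where x: "x \<in> C" "x \<in> F" by blast
    obtain y where y: "y \<in> E" "C = orbit G \<phi> y"
      using C by (auto simp: orbits_def)
    have xE: "x \<in> E" using x by (simp add: F_def)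
    have "y \<in> orbit G \<phi> x" using orbit_sym[OF y(1) xE] x(1) y(2) by simp
    then have "y = x" using x(2) unfolding F_def orbit_def by auto
    moreover have "orbit G \<phi> x = {x}"
      using x(2) orbit_refl[OF xE] unfolding F_def orbit_def by auto
    ultimately show ?thesis using y x by simp
  qed
  have "card F = (\<Sum>x\<in>E. if x \<in> F then 1 else 0)"
    using fin by (simp add: F_def sum.If_cases Int_def)
  also have "\<dots> = (\<Sum>C\<in>orbits G E \<phi>. \<Sum>x\<in>C. if x \<in> F then 1 else 0)"
    by (rule disjoint_sum[OF fin, symmetric])
  also have "\<dots> mod p = (\<Sum>C\<in>orbits G E \<phi>. card C) mod p"
    by (subst (1 2) mod_sum_eq[symmetric]) (simp add: orb)
  also have "(\<Sum>C\<in>orbits G E \<phi>. card C) = card E"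
    using disjoint_sum[OF fin, of "\<lambda>x. 1::nat"] by simp
  finally show ?thesis by (simp add: F_def)
qed

section \<open>Actions on right cosets and Sylow conjugation\<close>

lemma (in group) rcosets_r_coset_closed:
  assumes "subgroup H G" "U \<in> rcosets H" "x \<in> carrier G"
  shows "U #> x \<in> rcosets H"
  using assms by (auto simp: RCOSETS_def coset_mult_assoc subgroup.subset)

lemma (in group) rcosets_subset_carrier:
  assumes "subgroup H G" "U \<in> rcosets H"
  shows "U \<subseteq> carrier G"
  using assms subgroup.rcosets_carrier[OF _ is_group] by blast

text \<open>The inverse turns right multiplication into a left action. The maps are restricted to
  the cosets because members of \<open>BijGroup\<close> are extensional.\<close>

lemma (in group) r_coset_action:
  assumes H: "subgroup H G" and Q: "subgroup Q G"
  shows "group_action (G\<lparr>carrier := Q\<rparr>) (rcosets H) (\<lambda>q. \<lambda>U\<in>rcosets H. U #> inv q)"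
proof -
  note sub = rcosets_subset_carrier[OF H] and cl = rcosets_r_coset_closed[OF H]
  have "(\<lambda>q. \<lambda>U\<in>rcosets H. U #> inv q) \<in> hom G (BijGroup (rcosets H))"
  proof (rule homI)
    fix q assume q: "q \<in> carrier G"
    have "bij_betw (\<lambda>U\<in>rcosets H. U #> inv q) (rcosets H) (rcosets H)"
    proof (rule bij_betwI[where g = "\<lambda>U. U #> q"])
    qed (use q cl sub in \<open>auto simp: coset_mult_assoc\<close>)
    then show "(\<lambda>U\<in>rcosets H. U #> inv q) \<in> carrier (BijGroup (rcosets H))"
      by (auto simp: BijGroup_def Bij_def)
    fix r assume r: "r \<in> carrier G"
    have "bij_betw (\<lambda>U\<in>rcosets H. U #> inv r) (rcosets H) (rcosets H)"
    proof (rule bij_betwI[where g = "\<lambda>U. U #> r"])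
    qed (use r cl sub in \<open>auto simp: coset_mult_assoc\<close>)
    then show "(\<lambda>U\<in>rcosets H. U #> inv (q \<otimes> r)) =
        (\<lambda>U\<in>rcosets H. U #> inv q) \<otimes>\<^bsub>BijGroup (rcosets H)\<^esub> (\<lambda>U\<in>rcosets H. U #> inv r)"
      using \<open>bij_betw (\<lambda>U\<in>rcosets H. U #> inv q) _ _\<close> q r cl sub
      by (auto simp: BijGroup_def Bij_def compose_def coset_mult_assoc inv_mult_group
          intro!: restrict_ext)
  qed
  then interpret group_action G "rcosets H" "\<lambda>q. \<lambda>U\<in>rcosets H. U #> inv q"
    by (simp add: group_action_def group_hom_def group_hom_axioms_def group_BijGroup)
  show ?thesis by (rule induced_action[OF Q])
qed

lemma (in group) p_subgroup_fixed_rcosets: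
  assumes fin: "finite (carrier G)" and p: "Factorial_Ring.prime p"
    and H: "subgroup H G" and Q: "subgroup Q G" and card: "card Q = p ^ k"
  shows "card {U \<in> rcosets H. \<forall>q\<in>Q. U #> q = U} mod p = card (rcosets H) mod p"
proof -
  interpret A: group_action "G\<lparr>carrier := Q\<rparr>" "rcosets H" "\<lambda>q. \<lambda>U\<in>rcosets H. U #> inv q"
    by (rule r_coset_action[OF H Q])
  have "finite (rcosets H)"
    using fin by (simp add: RCOSETS_def)
  \<comment> \<open>\<open>Q\<close> is closed under inverses, so the inverse built into the action
    does not change the fixed points.\<close>
  moreover have "{U \<in> rcosets H. \<forall>q\<in>Q. U #> q = U} =
      {U \<in> rcosets H. \<forall>q\<in>Q. (\<lambda>U\<in>rcosets H. U #> inv q) U = U}"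
  proof -
    have "(\<forall>q\<in>Q. U #> q = U) \<longleftrightarrow> (\<forall>q\<in>Q. U #> inv q = U)" for U
      using subgroup.m_inv_closed[OF Q] subgroup.mem_carrier[OF Q] by (metis inv_inv)
    then show ?thesis by auto
  qed
  ultimately show ?thesis
    using A.p_group_fixed_points[OF p] card by (simp add: order_def)
qed

lemma (in group) r_coset_fixed_imp_conj:
  assumes "subgroup H G" "d \<in> carrier G" "q \<in> carrier G" "H #> d #> q = H #> d"
  shows "d \<otimes> q \<otimes> inv d \<in> H"
proof -
  have "d \<otimes> q \<in> H #> d"
    using assms rcos_self[OF m_closed assms(1), of d q]
    by (simp add: coset_mult_assoc subgroup.subset)
  then obtain h where "h \<in> H" "d \<otimes> q = h \<otimes> d" by (auto simp: r_coset_def)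
  then show ?thesis using assms(1-3)
    by (simp add: m_assoc subgroup.mem_carrier)
qed

text \<open>The number of cosets of \<open>H\<close> fixed by \<open>Q\<close> is congruent to the
  index of \<open>H\<close>, hence nonzero. A representative of a fixed coset conjugates
  \<open>Q\<close> into \<open>H\<close>. For \<open>H\<close> a Sylow subgroup this is Sylow's
  conjugacy theorem.\<close>

lemma (in group) p_subgroup_conj_into:
  assumes fin: "finite (carrier G)" and p: "Factorial_Ring.prime p"
    and H: "subgroup H G" and Q: "subgroup Q G" and card: "card Q = p ^ k"
    and ndvd: "\<not> p dvd card (rcosets H)"
  obtains d where "d \<in> carrier G" "\<And>q. q \<in> Q \<Longrightarrow> d \<otimes> q \<otimes> inv d \<in> H"
proof -
  have "{U \<in> rcosets H. \<forall>q\<in>Q. U #> q = U} \<noteq> {}"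
    using p_subgroup_fixed_rcosets[OF fin p H Q card] ndvd
    by (metis card.empty dvd_eq_mod_eq_0 mod_0)
  then obtain d where "d \<in> carrier G" "\<forall>q\<in>Q. H #> d #> q = H #> d"
    by (auto simp: RCOSETS_def)
  then show thesis
    using that r_coset_fixed_imp_conj[OF H] subgroup.mem_carrier[OF Q] by blast
qed

text \<open>The previous lemma is applied inside \<open>D\<close>: the index of \<open>H\<close> in
  \<open>D\<close> divides the index of \<open>H\<close> in \<open>G\<close>, so it is still prime
  to \<open>p\<close>. The gain is a conjugating element taken from \<open>D\<close>.\<close>

lemma (in group) p_subgroup_conj_into_sub:
  assumes fin: "finite (carrier G)" and p: "Factorial_Ring.prime p"
    and H: "subgroup H G" and Q: "subgroup Q G" and card: "card Q = p ^ k"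
    and ndvd: "\<not> p dvd card (rcosets H)"
    and D: "subgroup D G" "H \<subseteq> D" "Q \<subseteq> D"
  obtains d where "d \<in> D" "\<And>q. q \<in> Q \<Longrightarrow> d \<otimes> q \<otimes> inv d \<in> H"
proof -
  interpret D: group "G\<lparr>carrier := D\<rparr>" using D by (simp add: subgroup_imp_group)
  have finD: "finite D" using D fin by (meson finite_subset subgroup.subset)
  have HD: "subgroup H (G\<lparr>carrier := D\<rparr>)" and QD: "subgroup Q (G\<lparr>carrier := D\<rparr>)"
    using D H Q by (auto simp: subgroup_incl)
  define c where "c = card (rcosets\<^bsub>G\<lparr>carrier := D\<rparr>\<^esub> H)"
  have "c * card H = card D"
    using D.lagrange[OF HD] by (simp add: order_def c_def)
  moreover have "card D dvd order G"
    using lagrange[OF D(1)] by (metis dvd_triv_right)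
  moreover have "card (rcosets H) * card H = order G" using lagrange[OF H] .
  moreover have "card H \<noteq> 0" using H fin by (metis finite_subset subgroup.subset card_0_eq subgroup.one_closed empty_iff)
  ultimately have "c dvd card (rcosets H)"
    by (metis dvd_times_right_cancel_iff)
  then have "\<not> p dvd c" using ndvd dvd_trans by blast
  then obtain d where "d \<in> D" "\<And>q. q \<in> Q \<Longrightarrow> d \<otimes> q \<otimes> inv\<^bsub>G\<lparr>carrier := D\<rparr>\<^esub> d \<in> H"
    using D.p_subgroup_conj_into[OF _ p HD QD card] finD unfolding c_def by auto
  then show thesis using that m_inv_consistent[OF D(1)] by metis
qed

text \<open>Let \<open>H\<close> act on its own right cosets in \<open>P\<close>. The index is a
  proper power of \<open>p\<close>, so the number of fixed cosets is a multiple of \<open>p\<close>.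
  As \<open>H\<close> is one of them there is another, and its representatives normalize
  \<open>H\<close>.\<close>

lemma (in group) p_group_normalizer_grows:
  assumes fin: "finite (carrier G)" and p: "Factorial_Ring.prime p"
    and H: "subgroup H G" and P: "subgroup P G" and card: "card P = p ^ k"
    and HP: "H \<subset> P"
  obtains x where "x \<in> P" "x \<notin> H" "\<And>h. h \<in> H \<Longrightarrow> x \<otimes> h \<otimes> inv x \<in> H"
proof -
  interpret P: group "G\<lparr>carrier := P\<rparr>" using P by (simp add: subgroup_imp_group)
  let ?R = "rcosets\<^bsub>G\<lparr>carrier := P\<rparr>\<^esub> H"
  let ?F = "{U \<in> ?R. \<forall>q\<in>H. U #>\<^bsub>G\<lparr>carrier := P\<rparr>\<^esub> q = U}"
  have finP: "finite P" using P fin by (meson finite_subset subgroup.subset)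
  have HS: "subgroup H (G\<lparr>carrier := P\<rparr>)"
    using HP H P by (auto simp: subgroup_incl)
  have lag: "card ?R * card H = p ^ k"
    using P.lagrange[OF HS] card by (simp add: order_def)
  then obtain j where j: "card H = p ^ j" using p by (metis divides_primepow_nat dvd_triv_right)
  obtain i where i: "card ?R = p ^ i" using p lag by (metis divides_primepow_nat dvd_triv_left)
  have "i \<noteq> 0"
  proof
    assume "i = 0"
    then have "card H = card P" using lag card i by simp
    then show False using HP finP by (metis card_subset_eq psubset_eq)
  qed
  then have dvd: "p dvd card ?F"
    using P.p_subgroup_fixed_rcosets[OF _ p HS HS j] finP i
    by (simp add: mod_eq_0_iff_dvd)
  have HF: "H \<in> ?F"
  proof -
    have "H \<in> ?R" using subgroup.subgroup_in_rcosets[OF HS P.is_group] .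
    moreover have "H #>\<^bsub>G\<lparr>carrier := P\<rparr>\<^esub> q = H" if "q \<in> H" for q
      using P.coset_join2[OF _ HS that] HP that by auto
    ultimately show ?thesis by blast
  qed
  have "?F \<noteq> {H}"
  proof
    assume "?F = {H}"
    then have "card ?F = 1" by (metis card_1_singleton_iff One_nat_def)
    then show False using dvd p by simp
  qed
  then obtain U where U: "U \<in> ?F" "U \<noteq> H" using HF by blast
  then obtain x where x: "x \<in> P" "U = H #>\<^bsub>G\<lparr>carrier := P\<rparr>\<^esub> x"
    by (auto simp: RCOSETS_def)
  show thesis
  proof
    show "x \<in> P" by fact
    show "x \<notin> H" using x U P.coset_join2[OF _ HS] by auto
    fix h assume h: "h \<in> H"
    have "x \<otimes>\<^bsub>G\<lparr>carrier := P\<rparr>\<^esub> h \<otimes>\<^bsub>G\<lparr>carrier := P\<rparr>\<^esub> inv\<^bsub>G\<lparr>carrier := P\<rparr>\<^esub> x \<in> H"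
      using x U h HP by (intro P.r_coset_fixed_imp_conj[OF HS]) auto
    then show "x \<otimes> h \<otimes> inv x \<in> H" using m_inv_consistent[OF P x(1)] by simp
  qed
qed

subsection \<open>Transfer\<close>

text \<open>Induction on the size of \<open>C\<close>, splitting off one cycle of the permutation
  \<open>f\<close>; a cycle of length \<open>k\<close> contributes \<open>a [^] k\<close>. In the
  transfer, \<open>f\<close> is multiplication by an element on the cosets.\<close>

lemma (in comm_group) finprod_funpow_cycles:
  assumes "finite C" "bij_betw f C C" "W \<in> C \<rightarrow> carrier G" "a \<in> carrier G"
    and "\<And>c k. c \<in> C \<Longrightarrow> (f ^^ k) c = c \<Longrightarrow> finprod G (\<lambda>i. W ((f ^^ i) c)) {..<k} = a [^] k"
  shows "finprod G W C = a [^] card C"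
  using assms
proof (induction "card C" arbitrary: C rule: less_induct)
  case less
  show ?case
  proof (cases "C = {}")
    case True
    then show ?thesis by simp
  next
    case False
    then obtain c where c: "c \<in> C" by blast
    have bij: "bij_betw (f ^^ n) C C" for n
      using less.prems(2) by (rule bij_betw_funpow)
    have mem: "(f ^^ n) c \<in> C" for n
      using bij c by (meson bij_betwE)
    have "\<not> inj_on (\<lambda>n. (f ^^ n) c) UNIV"
      using mem less.prems(1) by (metis finite_imageD finite_subset image_subsetI infinite_UNIV_nat)
    then obtain i j where ij: "i < j" "(f ^^ i) c = (f ^^ j) c"
      by (auto simp: inj_on_def) (metis nat_neq_iff)
    have "(f ^^ i) ((f ^^ (j - i)) c) = (f ^^ i) c"
      using ij by (metis add_diff_inverse_nat comp_apply funpow_add not_less_iff_gr_or_eq)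
    then have "0 < j - i \<and> (f ^^ (j - i)) c = c"
      using ij bij mem c by (metis bij_betw_def inj_onD zero_less_diff)
    then obtain k where k: "0 < k" "(f ^^ k) c = c"
      and least: "\<And>m. 0 < m \<Longrightarrow> (f ^^ m) c = c \<Longrightarrow> k \<le> m"
      using exists_least_iff[of "\<lambda>m. 0 < m \<and> (f ^^ m) c = c"] by (metis not_le)
    \<comment> \<open>The cycle through \<open>c\<close>; minimality of the period \<open>k\<close>
      makes its \<open>k\<close> listed members distinct.\<close>
    define O' where "O' = (\<lambda>i. (f ^^ i) c) ` {..<k}"
    have inj: "inj_on (\<lambda>i. (f ^^ i) c) {..<k}"
    proof (rule linorder_inj_onI)
      fix i j assume ij: "i < j" "i \<in> {..<k}" "j \<in> {..<k}"
      show "(f ^^ i) c \<noteq> (f ^^ j) c"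
      proof
        assume eq: "(f ^^ i) c = (f ^^ j) c"
        have "(f ^^ i) ((f ^^ (j - i)) c) = (f ^^ i) c"
          using ij eq by (metis add_diff_inverse_nat comp_apply funpow_add not_less_iff_gr_or_eq)
        then have "(f ^^ (j - i)) c = c"
          using bij mem c by (metis bij_betw_def inj_onD)
        then show False using least[of "j - i"] ij by auto
      qed
    qed auto
    have O: "O' \<subseteq> C" "finite O'" "card O' = k"
      using mem inj by (auto simp: O'_def card_image)
    have "f ` O' \<subseteq> O'"
    proof
      fix y assume "y \<in> f ` O'"
      then obtain i where i: "i < k" "y = (f ^^ Suc i) c" by (auto simp: O'_def)
      show "y \<in> O'"
      proof (cases "Suc i < k")
        case True
        then show ?thesis using i unfolding O'_def by blast
      next
        case False
        then have "Suc i = k" using i by simp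
        then have "y = (f ^^ 0) c" using i k by simp
        then show ?thesis using k unfolding O'_def by blast
      qed
    qed
    moreover have injf: "inj_on f C" using less.prems(2) by (simp add: bij_betw_def)
    ultimately have "f ` O' = O'"
      using O by (meson card_image card_subset_eq inj_on_subset)
    then have fD: "bij_betw f (C - O') (C - O')"
      using less.prems(2) O injf
      by (metis Diff_subset bij_betw_def inj_on_image_set_diff inj_on_subset order_refl)
    have lt: "card (C - O') < card C"
      using O k less.prems(1) by (metis card_Diff_subset card_mono diff_less le_trans less_le_trans not_le)
    have IH: "finprod G W (C - O') = a [^] card (C - O')"
      using less.prems O by (intro less.hyps[OF lt _ fD]) auto
    have "finprod G W O' = finprod G (\<lambda>i. W ((f ^^ i) c)) {..<k}"
      unfolding O'_def using inj less.prems(3) mem by (intro finprod_reindex) auto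
    also have "\<dots> = a [^] card O'" using less.prems(5)[OF c k(2)] O by simp
    finally have "finprod G W O' = a [^] card O'" .
    moreover have "finprod G W ((C - O') \<union> O') = finprod G W (C - O') \<otimes> finprod G W O'"
      using less.prems O by (intro finprod_Un_disjoint) auto
    moreover have "(C - O') \<union> O' = C" using O by auto
    moreover have "card (C - O') + card O' = card C"
      using O(1,2) less.prems(1) card_mono[OF less.prems(1) O(1)] by (simp only: card_Diff_subset le_add_diff_inverse2)
    ultimately show ?thesis using IH less.prems(4) by (metis nat_pow_mult)
  qed
qed

text \<open>The transfer extends \<open>\<phi>\<close> to a homomorphism from \<open>G\<close> to
  the abelian group \<open>A\<close>, which is trivial because \<open>G\<close> is perfect.
  Evaluated along the cycles of \<open>u\<close> on the cosets of \<open>P\<close>, it is a product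
  of values of \<open>\<phi>\<close> at conjugates of powers of \<open>u\<close>, and stability
  turns this into a power of \<open>\<phi> u\<close>.\<close>

lemma (in group) transfer_of_perfect_trivial:
  assumes fin: "finite (carrier G)" and perf: "derived G (carrier G) = carrier G"
    and P: "subgroup P G" and A: "comm_group A"
    and hom: "\<phi> \<in> hom (G\<lparr>carrier := P\<rparr>) A" and u: "u \<in> P"
    and stable: "\<And>g n. g \<in> carrier G \<Longrightarrow> g \<otimes> u [^] (n::nat) \<otimes> inv g \<in> P
        \<Longrightarrow> \<phi> (g \<otimes> u [^] n \<otimes> inv g) = \<phi> u [^]\<^bsub>A\<^esub> n"
  shows "\<phi> u [^]\<^bsub>A\<^esub> card (rcosets P) = \<one>\<^bsub>A\<^esub>"
proof -
  interpret A: comm_group A by fact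
  interpret P: subgroup P G by fact
  interpret PG: group "G\<lparr>carrier := P\<rparr>" by (rule subgroup_imp_group[OF P])
  interpret \<phi>: group_hom "G\<lparr>carrier := P\<rparr>" A \<phi>
    using hom by (simp add: group_hom_def group_hom_axioms_def PG.is_group A.is_group)
  have hm: "\<phi> (x \<otimes> y) = \<phi> x \<otimes>\<^bsub>A\<^esub> \<phi> y" if "x \<in> P" "y \<in> P" for x y
    using \<phi>.hom_mult that by simp
  have hc: "\<phi> x \<in> carrier A" if "x \<in> P" for x using \<phi>.hom_closed that by simp
  define t where "t U = (SOME x. x \<in> U)" for U :: "'a set"
  have finR: "finite (rcosets P)" using fin by (simp add: RCOSETS_def)
  note cl = rcosets_r_coset_closed[OF P] and sub = rcosets_subset_carrier[OF P]
  have t: "t U \<in> U" "t U \<in> carrier G" "U = P #> t U" if U: "U \<in> rcosets P" for U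
  proof -
    obtain x where x: "x \<in> carrier G" "U = P #> x" using U by (auto simp: RCOSETS_def)
    then have "x \<in> U" using rcos_self[OF _ P] by simp
    then show 1: "t U \<in> U" unfolding t_def by (rule someI)
    then show "t U \<in> carrier G" using sub[OF U] by blast
    show "U = P #> t U" using 1 x P repr_independence by blast
  qed
  \<comment> \<open>With \<open>t\<close> a choice of coset representatives, this is the element of
    \<open>P\<close> by which \<open>t U \<otimes> x\<close> differs from the representative of its
    own coset.\<close>
  define w where "w x U = t U \<otimes> x \<otimes> inv t (U #> x)" for x U
  have w: "w x U \<in> P" if x: "x \<in> carrier G" and U: "U \<in> rcosets P" for x U
  proof -
    have "t U \<otimes> x \<in> U #> x" using t(1)[OF U] by (auto simp: r_coset_def)
    also have "U #> x = P #> t (U #> x)" by (rule t(3)[OF cl[OF U x]])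
    finally obtain h where h: "h \<in> P" "t U \<otimes> x = h \<otimes> t (U #> x)"
      by (auto simp: r_coset_def)
    then show ?thesis
      using t(2)[OF U] t(2)[OF cl[OF U x]] x
      by (simp add: w_def inv_solve_right' P.mem_carrier m_assoc)
  qed
  \<comment> \<open>The transfer. It is multiplicative by the cocycle identity for \<open>w\<close>
    and because multiplication by \<open>x\<close> permutes the cosets.\<close>
  define V where "V x = finprod A (\<lambda>U. \<phi> (w x U)) (rcosets P)" for x
  have bij: "bij_betw (\<lambda>U. U #> x) (rcosets P) (rcosets P)" if x: "x \<in> carrier G" for x
    by (rule bij_betwI[where g = "\<lambda>U. U #> inv x"])
       (use x cl sub in \<open>auto simp: coset_mult_assoc\<close>)
  have cocycle: "w (x \<otimes> y) U = w x U \<otimes> w y (U #> x)"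
    if xy: "x \<in> carrier G" "y \<in> carrier G" and U: "U \<in> rcosets P" for x y U
  proof -
    have "U #> (x \<otimes> y) = U #> x #> y" using xy sub[OF U] by (simp add: coset_mult_assoc)
    moreover have "inv t (U #> x) \<otimes> (t (U #> x) \<otimes> z) = z" if "z \<in> carrier G" for z
      using t(2)[OF cl[OF U xy(1)]] that by (simp add: m_assoc[symmetric])
    ultimately show ?thesis
      using xy t(2)[OF U] t(2)[OF cl[OF U xy(1)]] t(2)[OF cl[OF cl[OF U xy(1)] xy(2)]]
      by (simp add: w_def m_assoc)
  qed
  have V_hom: "V \<in> hom G A"
  proof (rule homI)
    fix x assume x: "x \<in> carrier G"
    show "V x \<in> carrier A" unfolding V_def using w[OF x] hc by (intro A.finprod_closed) auto
    fix y assume y: "y \<in> carrier G"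
    have "V (x \<otimes> y) = finprod A (\<lambda>U. \<phi> (w x U) \<otimes>\<^bsub>A\<^esub> \<phi> (w y (U #> x))) (rcosets P)"
      unfolding V_def
      using w x y cl hc by (intro A.finprod_cong) (auto simp: cocycle hm simp_implies_def)
    also have "\<dots> = V x \<otimes>\<^bsub>A\<^esub> finprod A (\<lambda>U. \<phi> (w y (U #> x))) (rcosets P)"
      unfolding V_def using w x y cl hc by (intro A.finprod_multf) auto
    also have "finprod A (\<lambda>U. \<phi> (w y (U #> x))) (rcosets P) = V y"
    proof -
      have "finprod A (\<lambda>U. \<phi> (w y U)) ((\<lambda>U. U #> x) ` (rcosets P)) =
          finprod A (\<lambda>U. \<phi> (w y (U #> x))) (rcosets P)"
        using bij[OF x] w[OF y] hc by (intro A.finprod_reindex) (auto simp: bij_betw_def)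
      then show ?thesis using bij[OF x] by (simp add: V_def bij_betw_def)
    qed
    finally show "V (x \<otimes> y) = V x \<otimes>\<^bsub>A\<^esub> V y" .
  qed
  then interpret V: group_hom G A V
    by (simp add: group_hom_def group_hom_axioms_def is_group A.is_group)
  have "V ` carrier G \<subseteq> carrier A" by auto
  then have "V ` carrier G \<subseteq> {\<one>\<^bsub>A\<^esub>}"
    using V.derived_img[of "carrier G"] perf A.derived_eq_singleton[of "V ` carrier G"] by simp
  then have "V u = \<one>\<^bsub>A\<^esub>" using P.mem_carrier[OF u] by blast
  moreover have "V u = \<phi> u [^]\<^bsub>A\<^esub> card (rcosets P)"
    unfolding V_def
  proof (rule A.finprod_funpow_cycles[OF finR bij])
    show "u \<in> carrier G" "\<phi> u \<in> carrier A" using u hc by auto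
    show "(\<lambda>U. \<phi> (w u U)) \<in> rcosets P \<rightarrow> carrier A" using w u hc by auto
    fix U and k :: nat assume U: "U \<in> rcosets P" and cyc: "((\<lambda>U. U #> u) ^^ k) U = U"
    have pow: "((\<lambda>U. U #> u) ^^ i) U = U #> u [^] i" for i :: nat
      using u U sub by (induction i) (auto simp: coset_mult_assoc)
    \<comment> \<open>By the cocycle identity, the product along \<open>k\<close> steps of a cycle
      telescopes.\<close>
    have prod: "finprod A (\<lambda>i. \<phi> (w u (U #> u [^] i))) {..<k} = \<phi> (w (u [^] k) U)" for k :: nat
    proof (induction k)
      case 0
      have "w \<one> U = \<one>" using t(2)[OF U] sub[OF U] by (simp add: w_def)
      then show ?case using \<phi>.hom_one by simp
    next
      case (Suc k)
      have c: "u [^] i \<in> carrier G" "U #> u [^] i \<in> rcosets P" for i :: nat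
        using u U cl by auto
      have "finprod A (\<lambda>i. \<phi> (w u (U #> u [^] i))) {..<Suc k} =
          \<phi> (w u (U #> u [^] k)) \<otimes>\<^bsub>A\<^esub> \<phi> (w (u [^] k) U)"
        using c w u hc Suc by (simp add: lessThan_Suc)
      also have "\<dots> = \<phi> (w (u [^] k) U) \<otimes>\<^bsub>A\<^esub> \<phi> (w u (U #> u [^] k))"
        using c w u hc U by (intro A.m_comm) auto
      also have "\<dots> = \<phi> (w (u [^] Suc k) U)"
        using c w u U by (simp add: cocycle hm)
      finally show ?case .
    qed
    \<comment> \<open>As the cycle closes after \<open>k\<close> steps, both representatives agree
      and a conjugate of \<open>u [^] k\<close> appears, to which \<open>stable\<close>
      applies.\<close>
    have "w (u [^] k) U = t U \<otimes> u [^] k \<otimes> inv t U"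
      using cyc pow by (simp add: w_def)
    then have "\<phi> (w (u [^] k) U) = \<phi> u [^]\<^bsub>A\<^esub> k"
      using stable[OF t(2)[OF U]] w[of "u [^] k" U] U u by simp
    then show "finprod A (\<lambda>i. \<phi> (w u (((\<lambda>U. U #> u) ^^ i) U))) {..<k} = \<phi> u [^]\<^bsub>A\<^esub> k"
      by (simp add: pow prod)
  qed
  ultimately show ?thesis by simp
qed

text \<open>The order of \<open>\<phi> u\<close> divides both \<open>p ^ k\<close> and, by the
  transfer, the index of \<open>P\<close>, which are coprime.\<close>

lemma (in group) stable_hom_of_perfect_trivial:
  assumes fin: "finite (carrier G)" and perf: "derived G (carrier G) = carrier G"
    and P: "subgroup P G" and card: "card P = p ^ k"
    and p: "Factorial_Ring.prime p" and ndvd: "\<not> p dvd card (rcosets P)"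
    and A: "comm_group A"
    and hom: "\<phi> \<in> hom (G\<lparr>carrier := P\<rparr>) A" and u: "u \<in> P"
    and stable: "\<And>g n. g \<in> carrier G \<Longrightarrow> g \<otimes> u [^] (n::nat) \<otimes> inv g \<in> P
        \<Longrightarrow> \<phi> (g \<otimes> u [^] n \<otimes> inv g) = \<phi> u [^]\<^bsub>A\<^esub> n"
  shows "\<phi> u = \<one>\<^bsub>A\<^esub>"
proof -
  interpret A: comm_group A by fact
  interpret PG: group "G\<lparr>carrier := P\<rparr>" by (rule subgroup_imp_group[OF P])
  interpret \<phi>: group_hom "G\<lparr>carrier := P\<rparr>" A \<phi>
    using hom by (simp add: group_hom_def group_hom_axioms_def PG.is_group A.is_group)
  have uA: "\<phi> u \<in> carrier A" using \<phi>.hom_closed u by simp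
  have "finite P" using P fin by (meson finite_subset subgroup.subset)
  then have "u [^]\<^bsub>G\<lparr>carrier := P\<rparr>\<^esub> (p ^ k) = \<one>"
    using PG.pow_order_eq_1[of u] u card by (simp add: order_def)
  then have "\<phi> u [^]\<^bsub>A\<^esub> (p ^ k) = \<one>\<^bsub>A\<^esub>"
    using \<phi>.hom_nat_pow[of u "p ^ k"] u \<phi>.hom_one by simp
  then have "A.ord (\<phi> u) dvd p ^ k" using A.pow_eq_id[OF uA] by blast
  moreover have "A.ord (\<phi> u) dvd card (rcosets P)"
    using transfer_of_perfect_trivial[OF fin perf P A hom u stable] A.pow_eq_id[OF uA] by blast
  moreover have "coprime (p ^ k) (card (rcosets P))"
    using p ndvd by (simp add: prime_imp_coprime)
  ultimately have "A.ord (\<phi> u) = 1"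
    by (meson coprime_common_divisor_nat nat_dvd_1_iff_1 coprime_common_divisor)
  then show ?thesis using A.pow_eq_id[OF uA, of 1] uA by simp
qed

subsection \<open>Minimal non-abelian p-groups\<close>

text \<open>\<open>normalizer\<close> asks for the conjugate of \<open>H\<close> to equal
  \<open>H\<close>; in a finite group, inclusion suffices by counting.\<close>

lemma (in group) normalizerI:
  assumes fin: "finite (carrier G)" and H: "subgroup H G" and x: "x \<in> carrier G"
    and conj: "\<And>h. h \<in> H \<Longrightarrow> x \<otimes> h \<otimes> inv x \<in> H"
  shows "x \<in> normalizer G H"
proof -
  interpret H: subgroup H G by fact
  have finH: "finite H" using fin H.subset finite_subset by blast
  have eq: "x <# H #> inv x = (\<lambda>h. x \<otimes> h \<otimes> inv x) ` H"
    by (auto simp: l_coset_def r_coset_def)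
  have "inj_on (\<lambda>h. x \<otimes> h \<otimes> inv x) H"
    using x conjugation_is_inj[OF x] by (auto simp: inj_on_def)
  then have "x <# H #> inv x = H"
    unfolding eq using conj finH by (intro card_subset_eq) (auto simp: card_image)
  then show ?thesis
    using x H.subset by (simp add: normalizer_def stabilizer_def)
qed

lemma (in group) generate_singleton_commute:
  assumes "a \<in> carrier G" "x \<in> generate G {a}" "y \<in> generate G {a}"
  shows "x \<otimes> y = y \<otimes> x"
proof -
  obtain i j :: int where "x = a [^] i" "y = a [^] j"
    using assms(2,3) generate_pow[OF assms(1)] by auto
  then show ?thesis using assms(1) by (metis int_pow_mult add.commute)
qed

text \<open>This is the preimage of the centralizer of the image of \<open>x\<close> in the quotient
  by the central subgroup \<open>C\<close>, written without the quotient. For trivial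
  \<open>C\<close> it is the centralizer of \<open>x\<close>.\<close>

lemma (in group) subgroup_commute_mod_central:
  assumes C: "subgroup C G" and central: "\<And>k y. k \<in> C \<Longrightarrow> y \<in> carrier G \<Longrightarrow> k \<otimes> y = y \<otimes> k"
    and x: "x \<in> carrier G"
  shows "subgroup {y \<in> carrier G. \<exists>k\<in>C. x \<otimes> y = k \<otimes> (y \<otimes> x)} G" (is "subgroup ?M G")
proof (rule subgroupI)
  interpret C: subgroup C G by fact
  show "?M \<subseteq> carrier G" by auto
  have "\<one> \<in> ?M" using x C.one_closed by force
  then show "?M \<noteq> {}" by blast
  fix y assume "y \<in> ?M"
  then obtain k where y: "y \<in> carrier G" and k: "k \<in> C" "x \<otimes> y = k \<otimes> (y \<otimes> x)" by blast
  have kc: "k \<in> carrier G" using k by auto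
  have "inv y \<otimes> x = inv y \<otimes> (x \<otimes> y) \<otimes> inv y" using x y by (simp add: m_assoc)
  also have "\<dots> = inv y \<otimes> (k \<otimes> y) \<otimes> x \<otimes> inv y" using x y kc k(2) by (simp add: m_assoc)
  also have "\<dots> = inv y \<otimes> (y \<otimes> k) \<otimes> x \<otimes> inv y" using central[OF k(1) y] by simp
  also have "\<dots> = k \<otimes> (x \<otimes> inv y)" using x y kc by (simp add: m_assoc[symmetric])
  finally have "x \<otimes> inv y = inv k \<otimes> (inv y \<otimes> x)"
    using x y kc by (simp add: inv_solve_left)
  then show "inv y \<in> ?M" using y C.m_inv_closed[OF k(1)] by blast
  fix y' assume "y' \<in> ?M"
  then obtain k' where y': "y' \<in> carrier G" and k': "k' \<in> C" "x \<otimes> y' = k' \<otimes> (y' \<otimes> x)" by blast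
  have kc': "k' \<in> carrier G" using k' by auto
  have "x \<otimes> (y \<otimes> y') = k \<otimes> y \<otimes> (x \<otimes> y')"
    using k x y y' kc by (simp add: m_assoc[symmetric])
  also have "\<dots> = k \<otimes> (y \<otimes> k') \<otimes> (y' \<otimes> x)"
    using k' x y y' kc kc' by (simp add: m_assoc)
  also have "\<dots> = (k \<otimes> k') \<otimes> ((y \<otimes> y') \<otimes> x)"
    using x y y' kc kc' by (simp only: central[OF k'(1) y, symmetric]) (simp add: m_assoc)
  finally show "y \<otimes> y' \<in> ?M" using y y' C.m_closed[OF k(1) k'(1)] by blast
qed

lemma (in group) generate_singleton_central:
  assumes c: "c \<in> carrier G" and cc: "\<And>y. y \<in> carrier G \<Longrightarrow> c \<otimes> y = y \<otimes> c"
    and k: "k \<in> generate G {c}" and y: "y \<in> carrier G"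
  shows "k \<otimes> y = y \<otimes> k"
proof -
  have M: "subgroup {x \<in> carrier G. \<exists>k\<in>{\<one>}. y \<otimes> x = k \<otimes> (x \<otimes> y)} G" (is "subgroup ?M G")
    using y by (intro subgroup_commute_mod_central triv_subgroup) auto
  have "{c} \<subseteq> ?M" using c y cc[OF y] by simp
  then have "generate G {c} \<subseteq> ?M" by (rule generate_subgroup_incl[OF _ M])
  then have "k \<in> carrier G" "y \<otimes> k = \<one> \<otimes> (k \<otimes> y)" using k by blast+
  then show ?thesis using y by simp
qed

text \<open>The cyclic group generated by \<open>a\<close> is proper, so it lies in a maximal proper
  subgroup. As normalizers grow, the normalizer of that subgroup is all of \<open>G\<close>.\<close>

lemma (in group) minimal_nonabelian_p_group_mem_normal:
  assumes fin: "finite (carrier G)" and p: "Factorial_Ring.prime p" and ord: "order G = p ^ k"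
    and nonab: "\<not> (\<forall>x\<in>carrier G. \<forall>y\<in>carrier G. x \<otimes> y = y \<otimes> x)"
    and a: "a \<in> carrier G"
  obtains A where "A \<lhd> G" "A \<noteq> carrier G" "a \<in> A"
proof -
  define S where "S = {A. subgroup A G \<and> A \<noteq> carrier G \<and> a \<in> A}"
  have "finite S" using fin
    by (rule_tac finite_subset[of _ "Pow (carrier G)"]) (auto simp: S_def subgroup.subset dest: subgroup.mem_carrier)
  moreover have "S \<noteq> {}"
  proof -
    have sub: "subgroup (generate G {a}) G" using a by (simp add: generate_is_subgroup)
    have "generate G {a} \<noteq> carrier G" using nonab generate_singleton_commute[OF a] by metis
    then show ?thesis using sub generate.incl[of a "{a}"] by (auto simp: S_def)
  qed
  ultimately obtain A where A: "A \<in> S" and max: "\<And>B. B \<in> S \<Longrightarrow> A \<subseteq> B \<Longrightarrow> A = B"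
    using finite_has_maximal by metis
  have As: "subgroup A G" "A \<subset> carrier G" "a \<in> A"
    using A by (auto simp: S_def subgroup.subset dest: subgroup.mem_carrier)
  obtain x where x: "x \<in> carrier G" "x \<notin> A" "\<And>h. h \<in> A \<Longrightarrow> x \<otimes> h \<otimes> inv x \<in> A"
    using p_group_normalizer_grows[OF fin p As(1) subgroup_self _ As(2)] ord
    unfolding order_def by metis
  let ?N = "normalizer G A"
  have nN: "A \<lhd> G\<lparr>carrier := ?N\<rparr>" by (rule subgroup_in_normalizer[OF As(1)])
  then have "A \<subseteq> ?N" using normal_imp_subgroup subgroup.subset by fastforce
  moreover have "x \<in> ?N" using normalizerI[OF fin As(1) x(1) x(3)] .
  moreover have "subgroup ?N G" by (rule normalizer_imp_subgroup[OF subgroup.subset[OF As(1)]])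
  ultimately have "?N = carrier G" using max[of ?N] x As(3) by (auto simp: S_def)
  then have "A \<lhd> G" using nN by simp
  then show thesis using that As by blast
qed

text \<open>By minimality two non-commuting elements \<open>a\<close>, \<open>b\<close> generate
  \<open>G\<close>, and their commutator \<open>c\<close> turns out to be central of order
  \<open>p\<close>. Then every commutator is a power of \<open>c\<close>, and any nontrivial element
  of a group of order \<open>p\<close> generates it.\<close>

lemma (in group) minimal_nonabelian_p_group_derived:
  assumes fin: "finite (carrier G)" and p: "Factorial_Ring.prime p" and ord: "order G = p ^ k"
    and nonab: "\<not> (\<forall>x\<in>carrier G. \<forall>y\<in>carrier G. x \<otimes> y = y \<otimes> x)"
    and min: "\<And>H. subgroup H G \<Longrightarrow> H \<noteq> carrier G \<Longrightarrow> \<forall>x\<in>H. \<forall>y\<in>H. x \<otimes> y = y \<otimes> x"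
    and z: "z \<in> derived G (carrier G)" "z \<noteq> \<one>"
  shows "derived G (carrier G) = generate G {z}"
proof -
  obtain a0 b where ab0: "a0 \<in> carrier G" "b \<in> carrier G" "a0 \<otimes> b \<noteq> b \<otimes> a0"
    using nonab by blast
  \<comment> \<open>Arranging that the p-th power of \<open>a\<close> commutes with \<open>b\<close> makes the commutator have order \<open>p\<close>.\<close>
  let ?P = "\<lambda>n. a0 [^] (p ^ n) \<otimes> b = b \<otimes> a0 [^] (p ^ n)"
  have "\<not> ?P 0" using ab0 by simp
  moreover have "?P k" using pow_order_eq_1[OF ab0(1)] ord ab0 by simp
  ultimately obtain n where n: "\<not> ?P n" "?P (Suc n)"
    using exists_least_lemma[of ?P] by blast
  define a where "a = a0 [^] (p ^ n)"
  have a: "a \<in> carrier G" and nc: "a \<otimes> b \<noteq> b \<otimes> a"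
    using n(1) ab0 by (auto simp: a_def)
  have ap: "a [^] p \<otimes> b = b \<otimes> a [^] p"
    using n(2) ab0 by (simp add: a_def nat_pow_pow mult.commute)
  note b = ab0(2)
  have full: "M = carrier G" if "subgroup M G" "a \<in> M" "b \<in> M" for M
    using min[OF that(1)] that nc by blast
  define c where "c = a \<otimes> b \<otimes> inv a \<otimes> inv b"
  have c: "c \<in> carrier G" using a b by (simp add: c_def)
  have abc: "a \<otimes> b = c \<otimes> (b \<otimes> a)"
  proof -
    have "c \<otimes> (b \<otimes> a) = a \<otimes> b \<otimes> (inv a \<otimes> (inv b \<otimes> b) \<otimes> a)"
      using a b by (simp only: c_def m_assoc m_closed inv_closed)
    then show ?thesis using a b by simp
  qed
  have c1: "c \<noteq> \<one>" using abc nc a b by auto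
  obtain A where A: "A \<lhd> G" "A \<noteq> carrier G" "a \<in> A"
    using minimal_nonabelian_p_group_mem_normal[OF fin p ord nonab a] .
  interpret A: normal A G by fact
  obtain B where B: "B \<lhd> G" "B \<noteq> carrier G" "b \<in> B"
    using minimal_nonabelian_p_group_mem_normal[OF fin p ord nonab b] .
  interpret B: normal B G by fact
  \<comment> \<open>The commutator lies in the normal subgroups \<open>A\<close> and
    \<open>B\<close>, which are abelian by minimality, so it commutes with \<open>a\<close> and with
    \<open>b\<close>.\<close>
  have "a \<otimes> (b \<otimes> inv a \<otimes> inv b) \<in> A"
    by (rule A.m_closed[OF A(3) A.inv_op_closed2[OF b A.m_inv_closed[OF A(3)]]])
  then have "c \<in> A" using a b by (simp add: c_def m_assoc)
  then have ca: "c \<otimes> a = a \<otimes> c" using min[OF A.subgroup_axioms A(2)] A(3) by blast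
  have "(a \<otimes> b \<otimes> inv a) \<otimes> inv b \<in> B"
    by (rule B.m_closed[OF B.inv_op_closed2[OF a B(3)] B.m_inv_closed[OF B(3)]])
  then have "c \<in> B" by (simp add: c_def)
  then have cb: "c \<otimes> b = b \<otimes> c" using min[OF B.subgroup_axioms B(2)] B(3) by blast
  \<comment> \<open>The set is the centralizer of \<open>c\<close>; it contains both
    generators.\<close>
  have eq: "{y \<in> carrier G. \<exists>k\<in>{\<one>}. c \<otimes> y = k \<otimes> (y \<otimes> c)} = carrier G"
    using a b c ca cb
    by (intro full subgroup_commute_mod_central triv_subgroup) auto
  have cc: "c \<otimes> y = y \<otimes> c" if y: "y \<in> carrier G" for y
  proof -
    have "c \<otimes> y = \<one> \<otimes> (y \<otimes> c)" using y eq by blast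
    then show ?thesis using c y by simp
  qed
  \<comment> \<open>At \<open>n = p\<close> the choice of \<open>a\<close> makes the power commute
    with \<open>b\<close>, which leaves \<open>c [^] p = \<one>\<close>.\<close>
  have "a [^] n \<otimes> b = c [^] n \<otimes> (b \<otimes> a [^] n)" for n :: nat
  proof (induction n)
    case 0
    then show ?case using b by simp
  next
    case (Suc n)
    have "a [^] Suc n \<otimes> b = a [^] n \<otimes> (c \<otimes> (b \<otimes> a))"
      using a b by (simp add: m_assoc abc)
    also have "\<dots> = c \<otimes> (a [^] n \<otimes> b) \<otimes> a"
      using a b c cc[of "a [^] n"] by (simp add: m_assoc[symmetric])
    also have "\<dots> = c \<otimes> c [^] n \<otimes> (b \<otimes> (a [^] n \<otimes> a))"
      using a b c by (simp add: Suc m_assoc)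
    also have "\<dots> = c [^] Suc n \<otimes> (b \<otimes> a [^] Suc n)"
      using c cc[of "c [^] n"] by simp
    finally show ?case .
  qed
  from this[of p] have "c [^] p \<otimes> (b \<otimes> a [^] p) = b \<otimes> a [^] p" using ap by simp
  then have cp: "c [^] p = \<one>" using a b c by simp
  let ?C = "generate G {c}"
  interpret C: subgroup ?C G using c by (simp add: generate_is_subgroup)
  have central: "k \<otimes> y = y \<otimes> k" if k: "k \<in> ?C" and y: "y \<in> carrier G" for k y
    using generate_singleton_central[OF c cc k y] .
  \<comment> \<open>Commuting modulo \<open>?C\<close> is symmetric. First \<open>M a\<close> and
    \<open>M b\<close> are everything, since each contains \<open>a\<close> and \<open>b\<close>;
    hence every \<open>M x\<close> contains \<open>a\<close> and \<open>b\<close> and is everything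
    too.\<close>
  define M where "M x = {y \<in> carrier G. \<exists>k\<in>?C. x \<otimes> y = k \<otimes> (y \<otimes> x)}" for x
  have Msub: "subgroup (M x) G" if "x \<in> carrier G" for x
    unfolding M_def using that by (intro subgroup_commute_mod_central C.subgroup_axioms central)
  have Msym: "x \<in> M y" if xy: "y \<in> M x" "x \<in> carrier G" for x y
  proof -
    obtain k where k: "y \<in> carrier G" "k \<in> ?C" "x \<otimes> y = k \<otimes> (y \<otimes> x)"
      using xy by (auto simp: M_def)
    then have "y \<otimes> x = inv k \<otimes> (x \<otimes> y)" using xy by (simp add: inv_solve_left)
    then show ?thesis using k xy C.m_inv_closed[OF k(2)] by (auto simp: M_def)
  qed
  have self: "x \<in> M x" if "x \<in> carrier G" for x
    using that C.one_closed by (force simp: M_def)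
  have "b \<in> M a" using abc b generate.incl[of c "{c}" G] by (auto simp: M_def)
  then have Ma: "M a = carrier G" and Mb: "M b = carrier G"
    using full[OF Msub] self a b Msym by blast+
  have M: "M x = carrier G" if x: "x \<in> carrier G" for x
    using full[OF Msub[OF x]] Msym Ma Mb a b x by blast
  have "derived_set G (carrier G) \<subseteq> ?C"
  proof clarsimp
    fix x y assume xy: "x \<in> carrier G" "y \<in> carrier G"
    then obtain k where k: "k \<in> ?C" "x \<otimes> y = k \<otimes> (y \<otimes> x)" using M[OF xy(1)] by (auto simp: M_def)
    have "k \<otimes> (y \<otimes> x) \<otimes> inv x \<otimes> inv y = k" using xy k(1) by (simp add: m_assoc)
    then show "x \<otimes> y \<otimes> inv x \<otimes> inv y \<in> ?C" using k by simp
  qed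
  then have der: "derived G (carrier G) \<subseteq> ?C"
    unfolding derived_def by (rule generate_subgroup_incl[OF _ C.subgroup_axioms])
  have zC: "z \<in> ?C" using der z by blast
  have zc: "z \<in> carrier G" using zC by simp
  have "z [^] p = \<one>"
  proof -
    obtain i :: int where "z = c [^] i" using zC generate_pow[OF c] by auto
    then have "z [^] int p = (c [^] int p) [^] i"
      using c by (simp add: int_pow_pow mult.commute)
    then show ?thesis using cp by (simp add: int_pow_int)
  qed
  then have "ord z dvd p" using pow_eq_id[OF zc] by simp
  moreover have "ord z \<noteq> 1" using z(2) ord_eq_1[OF zc] by blast
  ultimately have ordz: "ord z = p" using p by (meson prime_nat_iff)
  have "ord c dvd p" using cp pow_eq_id[OF c] by simp
  moreover have "ord c \<noteq> 1" using c1 ord_eq_1[OF c] by blast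
  ultimately have ordc: "ord c = p" using p by (meson prime_nat_iff)
  have sub: "generate G {z} \<subseteq> ?C"
    using zC by (intro generate_subgroup_incl C.subgroup_axioms) auto
  have "generate G {z} = ?C"
  proof (rule card_subset_eq[OF _ sub])
    show "finite ?C" using fin C.subset finite_subset by blast
    show "card (generate G {z}) = card ?C"
      using ordz ordc generate_pow_card[OF zc] generate_pow_card[OF c] by simp
  qed
  moreover have "generate G {z} \<subseteq> derived G (carrier G)"
    using z by (intro generate_subgroup_incl derived_is_subgroup) auto
  ultimately show ?thesis using der by blast
qed

subsection \<open>Self-normalizing subgroups of perfect groups\<close>

lemma (in group) sylow_subgroup_exists:
  assumes fin: "finite (carrier G)" and p: "Factorial_Ring.prime p"
  obtains P k where "subgroup P G" "card P = p ^ k" "\<not> p dvd card (rcosets P)"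
proof -
  have "order G \<noteq> 0" using fin order_gt_0_iff_finite by simp
  moreover have "\<not> is_unit p" using p not_prime_unit by blast
  ultimately obtain m where m: "order G = p ^ multiplicity p (order G) * m" "\<not> p dvd m"
    by (rule multiplicity_decompose')
  obtain P where P: "subgroup P G" "card P = p ^ multiplicity p (order G)"
    using sylow_thm[OF p is_group m(1) fin] by blast
  have "card (rcosets P) * p ^ multiplicity p (order G) = m * p ^ multiplicity p (order G)"
    using lagrange[OF P(1)] P(2) m(1) by (simp only: mult.commute)
  then have "card (rcosets P) = m" using p by (simp add: prime_gt_0_nat)
  then show thesis using that P m(2) by blast
qed

lemma (in group) commutative_subset_derived:
  assumes "subgroup H G" "\<forall>x\<in>H. \<forall>y\<in>H. x \<otimes> y = y \<otimes> x"
  shows "derived G H = {\<one>}"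
proof -
  interpret H: group "G\<lparr>carrier := H\<rparr>" by (rule subgroup_imp_group[OF assms(1)])
  have "comm_group (G\<lparr>carrier := H\<rparr>)"
    using assms(2) by (intro H.group_comm_groupI) auto
  then show ?thesis
    using comm_group.derived_eq_singleton[of "G\<lparr>carrier := H\<rparr>" H] derived_consistent[OF _ assms(1), of H]
    by simp
qed

text \<open>The conjugate of \<open>P\<close> by \<open>inv g\<close> is a subgroup containing
  \<open>x\<close>, hence all that \<open>x\<close> generates.\<close>

lemma (in group) generate_singleton_conj:
  assumes P: "subgroup P G" and g: "g \<in> carrier G" and x: "x \<in> carrier G"
    and conj: "g \<otimes> x \<otimes> inv g \<in> P" and h: "h \<in> generate G {x}"
  shows "g \<otimes> h \<otimes> inv g \<in> P"
proof -
  have Q: "inv g <# P #> g = (\<lambda>p. inv g \<otimes> p \<otimes> g) ` P"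
    by (auto simp: l_coset_def r_coset_def)
  have canc: "inv g \<otimes> (g \<otimes> y) = y" "g \<otimes> (inv g \<otimes> y) = y" if "y \<in> carrier G" for y
    using that g by (simp_all add: m_assoc[symmetric])
  have "x = inv g \<otimes> (g \<otimes> x \<otimes> inv g) \<otimes> g" using g x by (simp add: m_assoc canc)
  then have "{x} \<subseteq> inv g <# P #> g" using conj unfolding Q by blast
  then have "generate G {x} \<subseteq> inv g <# P #> g"
    by (rule generate_subgroup_incl[OF _ subgroup_conjugation_is_surj1[OF g P]])
  then obtain p where "p \<in> P" "h = inv g \<otimes> p \<otimes> g" using h unfolding Q by blast
  then show ?thesis using g subgroup.mem_carrier[OF P] by (simp add: m_assoc canc)
qed

text \<open>A nontrivial Sylow subgroup \<open>P\<close> turns out to be cyclic, with no two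
  distinct elements conjugate in \<open>G\<close>. The identity map on \<open>P\<close> is then
  stable, and the transfer forces \<open>P\<close> to be trivial.\<close>

lemma (in group) selfnormalizing_perfect_trivial:
  assumes fin: "finite (carrier G)" and perf: "derived G (carrier G) = carrier G"
    and sn: "\<And>B g. subgroup B G \<Longrightarrow> B \<noteq> {\<one>} \<Longrightarrow> g \<in> carrier G
        \<Longrightarrow> (\<And>b. b \<in> B \<Longrightarrow> g \<otimes> b \<otimes> inv g \<in> B) \<Longrightarrow> g \<in> B"
  shows "carrier G = {\<one>}"
proof (rule ccontr)
  assume nt: "carrier G \<noteq> {\<one>}"
  then have "order G \<noteq> 1" using order_one_triv_iff by simp
  then obtain p where p: "Factorial_Ring.prime p" "p dvd order G"
    using prime_factor_nat by blast
  obtain P k where P: "subgroup P G" "card P = p ^ k" "\<not> p dvd card (rcosets P)"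
    using sylow_subgroup_exists[OF fin p(1)] .
  interpret P: subgroup P G by fact
  interpret PG: group "G\<lparr>carrier := P\<rparr>" by (rule subgroup_imp_group[OF P(1)])
  have "P \<noteq> {\<one>}"
    using P(3) p(2) lagrange[OF P(1)] by auto
  then obtain u where u: "u \<in> P" "u \<noteq> \<one>" using P.one_closed by blast
  \<comment> \<open>Otherwise its normalizer in \<open>P\<close> would be larger, against
    self-normalization.\<close>
  have cyc: "generate G {x} = P" if x: "x \<in> P" "x \<noteq> \<one>" for x
  proof (rule ccontr)
    let ?H = "generate G {x}"
    have H: "subgroup ?H G" using x by (simp add: generate_is_subgroup)
    have xH: "x \<in> ?H" by (simp add: generate.incl)
    assume "?H \<noteq> P"
    moreover have "?H \<subseteq> P" using x by (intro generate_subgroup_incl P(1)) simp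
    ultimately have "?H \<subset> P" by blast
    then obtain g where g: "g \<in> P" "g \<notin> ?H" "\<And>h. h \<in> ?H \<Longrightarrow> g \<otimes> h \<otimes> inv g \<in> ?H"
      using p_group_normalizer_grows[OF fin p(1) H P(1,2)] by metis
    moreover have "?H \<noteq> {\<one>}" using xH x by blast
    ultimately show False using sn[OF H _ P.mem_carrier[OF g(1)]] by blast
  qed
  have comm: "x \<otimes> y = y \<otimes> x" if "x \<in> P" "y \<in> P" for x y
    using that generate_singleton_commute[of u x y] cyc[OF u] P.mem_carrier[OF u(1)] by blast
  then have A: "comm_group (G\<lparr>carrier := P\<rparr>)"
    by (intro PG.group_comm_groupI) auto
  have "u = \<one>\<^bsub>G\<lparr>carrier := P\<rparr>\<^esub>"
  proof (rule stable_hom_of_perfect_trivial[OF fin perf P(1,2) p(1) P(3) A _ u(1), of "\<lambda>x. x"])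
    show "(\<lambda>x. x) \<in> hom (G\<lparr>carrier := P\<rparr>) (G\<lparr>carrier := P\<rparr>)"
      by (auto simp: hom_def)
    fix g and n :: nat
    assume g: "g \<in> carrier G" and conj: "g \<otimes> u [^] n \<otimes> inv g \<in> P"
    define x where "x = u [^] n"
    have x: "x \<in> P" using u nat_pow_consistent[of u n P] PG.nat_pow_closed[of u n] by (simp add: x_def)
    have "g \<otimes> x \<otimes> inv g = x"
    proof (cases "x = \<one>")
      case False
      \<comment> \<open>Since \<open>x\<close> generates \<open>P\<close>, moving \<open>x\<close>
        into \<open>P\<close> already means normalizing \<open>P\<close>. So \<open>g\<close> lies
        in the abelian group \<open>P\<close> and fixes \<open>x\<close>.\<close>
      have "g \<otimes> h \<otimes> inv g \<in> P" if h: "h \<in> P" for h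
        using generate_singleton_conj[OF P(1) g P.mem_carrier[OF x] _, of h] cyc[OF x False] h conj
        by (simp only: x_def)
      then have "g \<in> P" using sn[OF P(1) \<open>P \<noteq> {\<one>}\<close> g] by blast
      then have "g \<otimes> x = x \<otimes> g" using comm x by blast
      then show ?thesis using x g by (simp add: m_assoc)
    qed (use g in simp)
    then show "g \<otimes> u [^] n \<otimes> inv g = u [^]\<^bsub>G\<lparr>carrier := P\<rparr>\<^esub> n"
      by (simp add: x_def nat_pow_consistent[symmetric])
  qed
  then show False using u by simp
qed

text \<open>The transfer into the abelianization of a Sylow subgroup \<open>P\<close> is used twice:
  on a central \<open>z\<close> of order \<open>p\<close>, to show that \<open>P\<close> is minimal
  non-abelian with derived subgroup generated by \<open>z\<close>, and then on all of
  \<open>P\<close>, which would make \<open>P\<close> central.\<close>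

lemma (in group) selfnormalizing_perfect_centerless:
  assumes fin: "finite (carrier G)" and perf: "derived G (carrier G) = carrier G"
    and sn: "\<And>A g. subgroup A G \<Longrightarrow> \<not> (\<forall>x\<in>A. \<forall>y\<in>A. x \<otimes> y = y \<otimes> x) \<Longrightarrow> g \<in> carrier G
        \<Longrightarrow> (\<And>a. a \<in> A \<Longrightarrow> g \<otimes> a \<otimes> inv g \<in> A) \<Longrightarrow> g \<in> A"
    and z0: "z0 \<in> carrier G" "\<And>y. y \<in> carrier G \<Longrightarrow> z0 \<otimes> y = y \<otimes> z0"
  shows "z0 = \<one>"
proof (rule ccontr)
  assume "z0 \<noteq> \<one>"
  then have "ord z0 \<noteq> 1" using ord_eq_1[OF z0(1)] by blast
  then obtain p where p: "Factorial_Ring.prime p" "p dvd ord z0"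
    using prime_factor_nat by blast
  define z where "z = z0 [^] (ord z0 div p)"
  have z: "z \<in> carrier G" using z0 by (simp add: z_def)
  have zy: "z \<otimes> y = y \<otimes> z" if y: "y \<in> carrier G" for y
  proof -
    have "z0 [^] n \<otimes> y = y \<otimes> z0 [^] n" for n :: nat
      using group_commutes_pow[OF z0(2)[OF y] z0(1) y] .
    then show ?thesis by (simp add: z_def)
  qed
  have ord0: "ord z0 > 0" using ord_ge_1[OF fin z0(1)] by simp
  have "z \<noteq> \<one>"
  proof
    assume "z = \<one>"
    then have "ord z0 dvd ord z0 div p" using pow_eq_id[OF z0(1)] by (simp add: z_def)
    moreover have "0 < ord z0 div p" "ord z0 div p < ord z0"
      using p ord0 prime_gt_1_nat[OF p(1)] by (auto elim!: dvdE)
    ultimately show False using dvd_imp_le by fastforce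
  qed
  moreover have "z [^] p = \<one>"
    using p(2) z0(1) by (simp add: z_def nat_pow_pow pow_ord_eq_1)
  ultimately have ordz: "ord z = p"
    using p(1) pow_eq_id[OF z] ord_eq_1[OF z] by (metis prime_nat_iff)
  define C where "C = generate G {z}"
  have C: "subgroup C G" using z by (simp add: C_def generate_is_subgroup)
  interpret C: subgroup C G by fact
  have zC: "z \<in> C" by (simp add: C_def generate.incl)
  have central: "k \<otimes> y = y \<otimes> k" if k: "k \<in> C" and y: "y \<in> carrier G" for k y
    using generate_singleton_central[OF z zy] k y by (simp add: C_def)
  have cardC: "card C = p ^ 1"
    using ordz generate_pow_card[OF z] by (simp add: C_def)
  obtain P k where P: "subgroup P G" "card P = p ^ k" "\<not> p dvd card (rcosets P)"
    using sylow_subgroup_exists[OF fin p(1)] .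
  interpret P: subgroup P G by fact
  let ?P = "G\<lparr>carrier := P\<rparr>"
  interpret PG: group ?P by (rule subgroup_imp_group[OF P(1)])
  have finP: "finite P" using fin P.subset finite_subset by blast
  have zP: "z \<in> P"
  proof -
    \<comment> \<open>Some conjugate of \<open>z\<close> lies in \<open>P\<close>, and
      \<open>z\<close> is its only conjugate.\<close>
    obtain d where d: "d \<in> carrier G" "\<And>q. q \<in> C \<Longrightarrow> d \<otimes> q \<otimes> inv d \<in> P"
      using p_subgroup_conj_into[OF fin p(1) P(1) C cardC P(3)] by blast
    have "d \<otimes> z \<otimes> inv d = z \<otimes> d \<otimes> inv d" using zy[OF d(1)] by simp
    then have "d \<otimes> z \<otimes> inv d = z" using d(1) z by (simp add: m_assoc)
    then show ?thesis using d(2)[OF zC] by simp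
  qed
  define D where "D = derived G P"
  have DP: "derived ?P P = D" using derived_consistent[OF _ P(1)] by (simp add: D_def)
  interpret D: normal D ?P using derived_subgroup_is_normal[OF P(1)] by (simp add: D_def)
  have A: "comm_group (?P Mod D)"
    unfolding D_def by (rule derived_quot_of_subgroup_is_comm_group[OF P(1)])
  \<comment> \<open>The projection of \<open>P\<close> onto its abelianization.\<close>
  define \<phi> where "\<phi> x = D #>\<^bsub>?P\<^esub> x" for x
  have hom: "\<phi> \<in> hom ?P (?P Mod D)"
    unfolding \<phi>_def by (rule D.r_coset_hom_Mod)
  interpret \<phi>: group_hom ?P "?P Mod D" \<phi>
    using hom A by (simp add: group_hom_def group_hom_axioms_def PG.is_group comm_group.axioms)
  have pow: "u [^] n \<in> P" "\<phi> (u [^] n) = \<phi> u [^]\<^bsub>?P Mod D\<^esub> n" if "u \<in> P" for u and n :: nat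
    using that PG.nat_pow_closed[of u n] \<phi>.hom_nat_pow[of u n] by (simp_all add: nat_pow_consistent[symmetric])
  have ker: "u \<in> D" if "u \<in> P" "\<phi> u = \<one>\<^bsub>?P Mod D\<^esub>" for u
    using that PG.rcos_self[OF _ D.subgroup_axioms, of u] by (simp add: \<phi>_def FactGroup_def)
  have "\<phi> z = \<one>\<^bsub>?P Mod D\<^esub>"
  proof (rule stable_hom_of_perfect_trivial[OF fin perf P(1,2) p(1) P(3) A hom zP])
    fix g and n :: nat assume g: "g \<in> carrier G"
    have "z [^] n \<in> C" using zC by (induction n) auto
    then have "g \<otimes> z [^] n \<otimes> inv g = z [^] n \<otimes> g \<otimes> inv g"
      using central[OF _ g] by simp
    then have "g \<otimes> z [^] n \<otimes> inv g = z [^] n" using g z by (simp add: m_assoc)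
    then show "\<phi> (g \<otimes> z [^] n \<otimes> inv g) = \<phi> z [^]\<^bsub>?P Mod D\<^esub> n"
      using pow[OF zP] by simp
  qed
  then have zD: "z \<in> D" using ker zP by blast
  have nonab: "\<not> (\<forall>x\<in>P. \<forall>y\<in>P. x \<otimes> y = y \<otimes> x)"
    using commutative_subset_derived[OF P(1)] zD \<open>z \<noteq> \<one>\<close> by (auto simp: D_def)
  have "derived ?P (carrier ?P) = generate ?P {z}"
  proof (rule PG.minimal_nonabelian_p_group_derived[OF _ p(1)])
    show "finite (carrier ?P)" "order ?P = p ^ k" using finP P(2) by (auto simp: order_def)
    show "\<not> (\<forall>x\<in>carrier ?P. \<forall>y\<in>carrier ?P. x \<otimes>\<^bsub>?P\<^esub> y = y \<otimes>\<^bsub>?P\<^esub> x)" using nonab by simp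
    show "z \<in> derived ?P (carrier ?P)" "z \<noteq> \<one>\<^bsub>?P\<^esub>" using zD DP \<open>z \<noteq> \<one>\<close> by auto
    \<comment> \<open>A proper subgroup of \<open>P\<close> is not self-normalizing, because
      normalizers grow, so it must be abelian.\<close>
    fix H assume H: "subgroup H ?P" "H \<noteq> carrier ?P"
    then have HG: "subgroup H G" "H \<subset> P"
      using incl_subgroup[OF P(1)] subgroup.subset[OF H(1)] by auto
    then obtain x where x: "x \<in> P" "x \<notin> H" "\<And>h. h \<in> H \<Longrightarrow> x \<otimes> h \<otimes> inv x \<in> H"
      using p_group_normalizer_grows[OF fin p(1) HG(1) P(1,2)] by metis
    have "\<forall>x\<in>H. \<forall>y\<in>H. x \<otimes> y = y \<otimes> x"
      using sn[OF HG(1) _ P.mem_carrier[OF x(1)] x(3)] x(2) by blast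
    then show "\<forall>x\<in>H. \<forall>y\<in>H. x \<otimes>\<^bsub>?P\<^esub> y = y \<otimes>\<^bsub>?P\<^esub> x" by simp
  qed
  then have DC: "D = C"
    using generate_consistent[OF _ P(1), of "{z}"] zP DP by (simp add: C_def)
  have commutator: "\<exists>k\<in>C. x \<otimes> y = k \<otimes> (y \<otimes> x)" if xy: "x \<in> P" "y \<in> P" for x y
  proof
    show "x \<otimes> y \<otimes> inv x \<otimes> inv y \<in> C"
      unfolding DC[symmetric] D_def derived_def using xy by (intro generate.incl) blast
    have "x \<otimes> y \<otimes> inv x \<otimes> inv y \<otimes> (y \<otimes> x) = x \<otimes> y \<otimes> (inv x \<otimes> (inv y \<otimes> y) \<otimes> x)"
      using xy by (simp only: m_assoc m_closed inv_closed P.mem_carrier)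
    then show "x \<otimes> y = x \<otimes> y \<otimes> inv x \<otimes> inv y \<otimes> (y \<otimes> x)" using xy by simp
  qed
  have conj_mod: "\<exists>k\<in>C. d \<otimes> x \<otimes> inv d = k \<otimes> x"
    if x: "x \<in> carrier G" and d: "d \<in> carrier G" and xd: "\<exists>k\<in>C. x \<otimes> d = k \<otimes> (d \<otimes> x)" for x d
  proof -
    obtain k where k: "k \<in> C" "x \<otimes> d = k \<otimes> (d \<otimes> x)" using xd by blast
    then have "d \<otimes> x = inv k \<otimes> (x \<otimes> d)" using x d by (simp add: inv_solve_left)
    then have "d \<otimes> x \<otimes> inv d = inv k \<otimes> x" using x d k(1) by (simp add: m_assoc)
    then show ?thesis using C.m_inv_closed[OF k(1)] by blast
  qed
  \<comment> \<open>The Burnside fusion argument modulo \<open>C\<close>: \<open>P\<close> and its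
    conjugate \<open>Q\<close> both lie in \<open>E\<close>, the group of elements commuting with
    \<open>x\<close> modulo \<open>C\<close>, so some \<open>d\<close> in \<open>E\<close>
    conjugates \<open>Q\<close> into \<open>P\<close>.\<close>
  have fusion: "\<phi> v = \<phi> x" if x: "x \<in> P" and g: "g \<in> carrier G" and v: "v \<in> P" "v = g \<otimes> x \<otimes> inv g" for x g v
  proof -
    define E where "E = {d \<in> carrier G. \<exists>k\<in>C. x \<otimes> d = k \<otimes> (d \<otimes> x)}"
    have E: "subgroup E G" unfolding E_def
      using x by (intro subgroup_commute_mod_central C central) auto
    have canc: "g \<otimes> (inv g \<otimes> y) = y" "inv g \<otimes> (g \<otimes> y) = y" if y: "y \<in> carrier G" for y
      using y g by (simp_all add: m_assoc[symmetric])
    have xv: "x = inv g \<otimes> v \<otimes> g" unfolding v(2) using g x by (simp add: m_assoc canc)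
    define Q where "Q = (\<lambda>h. inv g \<otimes> h \<otimes> g) ` P"
    have PE: "P \<subseteq> E" using commutator[OF x] by (auto simp: E_def)
    have "Q = inv g <# P #> g" by (auto simp: Q_def l_coset_def r_coset_def)
    then have Q: "subgroup Q G" using subgroup_conjugation_is_surj1[OF g P(1)] by simp
    have "inj_on (\<lambda>h. inv g \<otimes> h \<otimes> g) P"
      using g P.mem_carrier by (intro inj_onI) simp
    then have cQ: "card Q = p ^ k" using P(2) by (simp add: Q_def card_image)
    \<comment> \<open>\<open>P\<close> commutes with \<open>v\<close> modulo \<open>C\<close>;
      conjugating by \<open>inv g\<close> sends \<open>v\<close> to \<open>x\<close>,
      \<open>P\<close> to \<open>Q\<close>, and fixes the central subgroup \<open>C\<close>.\<close>
    have QE: "Q \<subseteq> E"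
    proof
      fix q assume "q \<in> Q"
      then obtain h where h: "h \<in> P" "q = inv g \<otimes> h \<otimes> g" by (auto simp: Q_def)
      obtain k where k: "k \<in> C" "v \<otimes> h = k \<otimes> (h \<otimes> v)" using commutator[OF v(1) h(1)] by blast
      have "x \<otimes> q = inv g \<otimes> (v \<otimes> h) \<otimes> g"
        unfolding xv h(2) using g h(1) v(1) by (simp add: m_assoc canc)
      also have "\<dots> = (inv g \<otimes> k) \<otimes> (h \<otimes> v) \<otimes> g"
        unfolding k(2) using g h(1) v(1) k(1) by (simp add: m_assoc)
      also have "inv g \<otimes> k = k \<otimes> inv g" using central[OF k(1)] g by simp
      also have "k \<otimes> inv g \<otimes> (h \<otimes> v) \<otimes> g = k \<otimes> (q \<otimes> x)"
        unfolding xv h(2) using g h(1) v(1) k(1) by (simp add: m_assoc canc)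
      finally have "x \<otimes> q = k \<otimes> (q \<otimes> x)" .
      moreover have "q \<in> carrier G" using h g by simp
      ultimately show "q \<in> E" unfolding E_def using k(1) by blast
    qed
    obtain d where d: "d \<in> E" "\<And>q. q \<in> Q \<Longrightarrow> d \<otimes> q \<otimes> inv d \<in> P"
      using p_subgroup_conj_into_sub[OF fin p(1) P(1) Q cQ P(3) E PE QE] by blast
    have dG: "d \<in> carrier G" using d by (simp add: E_def)
    \<comment> \<open>This element normalizes the non-abelian group \<open>P\<close>, hence lies in
      \<open>P\<close>. It sends \<open>v\<close> to the conjugate of \<open>x\<close> by
      \<open>d\<close>, and modulo \<open>C\<close> both conjugations change nothing.\<close>
    define f where "f = d \<otimes> inv g"
    have fG: "f \<in> carrier G" using dG g by (simp add: f_def)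
    have fc: "f \<otimes> h \<otimes> inv f = d \<otimes> (inv g \<otimes> h \<otimes> g) \<otimes> inv d" if "h \<in> carrier G" for h
      using dG g that by (simp add: f_def inv_mult_group m_assoc)
    have fP: "f \<in> P"
    proof (rule sn[OF P(1) nonab fG])
      fix a assume "a \<in> P"
      then show "f \<otimes> a \<otimes> inv f \<in> P" using fc d(2)[of "inv g \<otimes> a \<otimes> g"] by (simp add: Q_def)
    qed
    have "f \<otimes> v \<otimes> inv f = d \<otimes> x \<otimes> inv d"
      using fc[of v] v(1) xv by simp
    moreover obtain k where k: "k \<in> C" "d \<otimes> x \<otimes> inv d = k \<otimes> x"
      using conj_mod[of x d] d(1) x by (auto simp: E_def)
    moreover obtain l where l: "l \<in> C" "f \<otimes> v \<otimes> inv f = l \<otimes> v"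
      using conj_mod[of v f] commutator[OF v(1) fP] fP v(1) by auto
    ultimately have "l \<otimes> v = k \<otimes> x" by simp
    then have "v = inv l \<otimes> (k \<otimes> x)" using l(1) k(1) v(1) x by (simp add: inv_solve_left)
    then have "v = (inv l \<otimes> k) \<otimes> x" using l(1) k(1) x by (simp add: m_assoc)
    moreover have "inv l \<otimes> k \<in> D" using l(1) k(1) by (simp add: DC)
    ultimately have "v \<in> D #>\<^bsub>?P\<^esub> x" by (auto simp: r_coset_def)
    then show ?thesis unfolding \<phi>_def
      using PG.repr_independence[OF _ _ D.subgroup_axioms] x by simp
  qed
  \<comment> \<open>Fusion makes every \<open>u\<close> in \<open>P\<close> stable, so
    \<open>P\<close> lies in its derived subgroup \<open>D\<close>, which is
    \<open>C\<close>.\<close>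
  have "u \<in> C" if u: "u \<in> P" for u
  proof -
    have "\<phi> u = \<one>\<^bsub>?P Mod D\<^esub>"
    proof (rule stable_hom_of_perfect_trivial[OF fin perf P(1,2) p(1) P(3) A hom u])
      fix g and n :: nat assume "g \<in> carrier G" "g \<otimes> u [^] n \<otimes> inv g \<in> P"
      then show "\<phi> (g \<otimes> u [^] n \<otimes> inv g) = \<phi> u [^]\<^bsub>?P Mod D\<^esub> n"
        using fusion[OF pow(1)[OF u]] pow(2)[OF u] by simp
    qed
    then show ?thesis using ker u DC by blast
  qed
  then show False using nonab central P.mem_carrier by blast
qed

section \<open>The centralizer of a normal subgroup and its quotient\<close>

lemma (in group) centralizer_of_normal:
  assumes K: "K \<lhd> G"
  shows "{x \<in> carrier G. \<forall>k\<in>K. x \<otimes> k = k \<otimes> x} \<lhd> G" (is "?N \<lhd> G")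
proof (rule normal_invI)
  interpret K: normal K G by fact
  show N: "subgroup ?N G"
  proof (rule subgroupI)
    show "?N \<subseteq> carrier G" by auto
    have "\<one> \<in> ?N" using K.mem_carrier by simp
    then show "?N \<noteq> {}" by blast
    fix x assume x: "x \<in> ?N"
    show "inv x \<in> ?N"
    proof (clarsimp, intro conjI ballI)
      show "inv x \<in> carrier G" using x by simp
      fix k assume k: "k \<in> K"
      then have kc: "k \<in> carrier G" by simp
      have "inv x \<otimes> k = inv x \<otimes> (k \<otimes> x) \<otimes> inv x" using x kc by (simp add: m_assoc)
      also have "k \<otimes> x = x \<otimes> k" using x k by auto
      also have "inv x \<otimes> (x \<otimes> k) \<otimes> inv x = k \<otimes> inv x"
        using x kc by (simp add: m_assoc[symmetric])
      finally show "inv x \<otimes> k = k \<otimes> inv x" .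
    qed
    fix y assume y: "y \<in> ?N"
    show "x \<otimes> y \<in> ?N"
    proof (clarsimp, intro conjI ballI)
      show "x \<otimes> y \<in> carrier G" using x y by simp
      fix k assume k: "k \<in> K"
      then have kc: "k \<in> carrier G" by simp
      have "x \<otimes> y \<otimes> k = x \<otimes> (k \<otimes> y)" using x y k kc by (simp add: m_assoc)
      also have "\<dots> = (x \<otimes> k) \<otimes> y" using x y kc by (simp add: m_assoc)
      also have "x \<otimes> k = k \<otimes> x" using x k by auto
      finally show "x \<otimes> y \<otimes> k = k \<otimes> (x \<otimes> y)" using x y kc by (simp add: m_assoc)
    qed
  qed
  fix x h assume x: "x \<in> carrier G" and h: "h \<in> ?N"
  show "x \<otimes> h \<otimes> inv x \<in> ?N"
  proof (clarsimp, intro conjI ballI)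
    show "x \<otimes> h \<otimes> inv x \<in> carrier G" using x h by simp
    fix k assume k: "k \<in> K"
    have kc: "k \<in> carrier G" using k by simp
    have hc: "h \<in> carrier G" using h by simp
    have canc: "x \<otimes> (inv x \<otimes> y) = y" if y: "y \<in> carrier G" for y
      using y x by (simp add: m_assoc[symmetric])
    \<comment> \<open>Normality of \<open>K\<close> enters here: \<open>h\<close> commutes with the
      conjugate of \<open>k\<close>, and conjugating back gives the claim for
      \<open>k\<close>.\<close>
    have "inv x \<otimes> k \<otimes> x \<in> K" using K.inv_op_closed1[OF x k] .
    then have hk: "h \<otimes> (inv x \<otimes> k \<otimes> x) = (inv x \<otimes> k \<otimes> x) \<otimes> h" using h by auto
    have "x \<otimes> h \<otimes> inv x \<otimes> k = x \<otimes> (h \<otimes> (inv x \<otimes> k \<otimes> x)) \<otimes> inv x"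
      using x hc kc by (simp add: m_assoc)
    also have "\<dots> = k \<otimes> (x \<otimes> h \<otimes> inv x)"
      unfolding hk using x hc kc by (simp add: m_assoc canc)
    finally show "x \<otimes> h \<otimes> inv x \<otimes> k = k \<otimes> (x \<otimes> h \<otimes> inv x)" .
  qed
qed

text \<open>The quotient by the centralizer \<open>N\<close> of \<open>K\<close> is perfect with all
  nontrivial subgroups self-normalizing, hence trivial. So \<open>K\<close> is central, and the
  center is trivial.\<close>

lemma (in group) selfnormalizing_perfect_abelian_normal:
  assumes fin: "finite (carrier G)" and perf: "derived G (carrier G) = carrier G"
    and sn: "\<And>A g. subgroup A G \<Longrightarrow> \<not> (\<forall>x\<in>A. \<forall>y\<in>A. x \<otimes> y = y \<otimes> x) \<Longrightarrow> g \<in> carrier G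
        \<Longrightarrow> (\<And>a. a \<in> A \<Longrightarrow> g \<otimes> a \<otimes> inv g \<in> A) \<Longrightarrow> g \<in> A"
    and K: "K \<lhd> G" and comm: "\<forall>x\<in>K. \<forall>y\<in>K. x \<otimes> y = y \<otimes> x"
  shows "K = {\<one>}"
proof -
  interpret K: normal K G by fact
  define N where "N = {x \<in> carrier G. \<forall>k\<in>K. x \<otimes> k = k \<otimes> x}"
  interpret N: normal N G unfolding N_def by (rule centralizer_of_normal[OF K])
  interpret S: group "G Mod N" by (rule N.factorgroup_is_group)
  interpret \<pi>: group_hom G "G Mod N" "\<lambda>x. N #> x"
    by (intro group_hom.intro group_hom_axioms.intro is_group S.is_group N.r_coset_hom_Mod)
  have KN: "K \<subseteq> N" using comm K.subset unfolding N_def by blast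
  have surj: "(\<lambda>x. N #> x) ` carrier G = carrier (G Mod N)"
    by (auto simp: FactGroup_def RCOSETS_def)
  have one: "\<one>\<^bsub>G Mod N\<^esub> = N" by (simp add: FactGroup_def)
  have ker: "x \<in> N" if "x \<in> carrier G" "N #> x = N" for x
    using that rcos_self[OF that(1) N.subgroup_axioms] by simp
  have "carrier (G Mod N) = {\<one>\<^bsub>G Mod N\<^esub>}"
  proof (rule S.selfnormalizing_perfect_trivial)
    show "finite (carrier (G Mod N))" using fin surj by (metis finite_imageI)
    show "derived (G Mod N) (carrier (G Mod N)) = carrier (G Mod N)"
      using \<pi>.derived_img[of "carrier G"] perf surj by simp
    fix B s assume B: "subgroup B (G Mod N)" "B \<noteq> {\<one>\<^bsub>G Mod N\<^esub>}" and s: "s \<in> carrier (G Mod N)"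
      and norm: "\<And>b. b \<in> B \<Longrightarrow> s \<otimes>\<^bsub>G Mod N\<^esub> b \<otimes>\<^bsub>G Mod N\<^esub> inv\<^bsub>G Mod N\<^esub> s \<in> B"
    interpret B: subgroup B "G Mod N" by fact
    \<comment> \<open>The preimage of \<open>B\<close> contains \<open>K\<close>, as
      \<open>K\<close> is abelian, and some element outside \<open>N\<close>, which fails to commute
      with a member of \<open>K\<close>. So \<open>A\<close> is non-abelian and self-normalizing,
      and this passes down to \<open>B\<close>.\<close>
    define A where "A = {x \<in> carrier G. N #> x \<in> B}"
    have A: "subgroup A G"
    proof (rule subgroupI)
      show "A \<subseteq> carrier G" by (auto simp: A_def)
      have "\<one> \<in> A" using \<pi>.hom_one B.one_closed by (simp add: A_def)
      then show "A \<noteq> {}" by blast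
      fix x assume x: "x \<in> A"
      show "inv x \<in> A" using x \<pi>.hom_inv[of x] B.m_inv_closed[of "N #> x"] by (simp add: A_def)
      fix y assume y: "y \<in> A"
      show "x \<otimes> y \<in> A" using x y \<pi>.hom_mult[of x y] B.m_closed[of "N #> x" "N #> y"] by (simp add: A_def)
    qed
    obtain b where b: "b \<in> B" "b \<noteq> N" using B(2) B.one_closed one by auto
    then obtain x where x: "x \<in> carrier G" "b = N #> x" using surj B.subset by blast
    have xA: "x \<in> A" using x b by (simp add: A_def)
    have "x \<notin> N" using b x N.rcos_const[OF is_group] by blast
    then obtain k where k: "k \<in> K" "x \<otimes> k \<noteq> k \<otimes> x" using x(1) unfolding N_def by blast
    have "N #> k = N" using k KN N.rcos_const[OF is_group] by blast
    then have kA: "k \<in> A" using k B.one_closed one by (simp add: A_def)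
    obtain g where g: "g \<in> carrier G" "s = N #> g" using s surj by blast
    have "g \<in> A"
    proof (rule sn[OF A _ g(1)])
      show "\<not> (\<forall>x\<in>A. \<forall>y\<in>A. x \<otimes> y = y \<otimes> x)" using xA kA k by blast
      fix a assume a: "a \<in> A"
      then have ac: "a \<in> carrier G" by (simp add: A_def)
      have "N #> (g \<otimes> a \<otimes> inv g) = s \<otimes>\<^bsub>G Mod N\<^esub> (N #> a) \<otimes>\<^bsub>G Mod N\<^esub> inv\<^bsub>G Mod N\<^esub> s"
        using \<pi>.hom_mult[OF m_closed[OF g(1) ac] inv_closed[OF g(1)]] \<pi>.hom_mult[OF g(1) ac] \<pi>.hom_inv[OF g(1)] g(2)
        by simp
      also have "\<dots> \<in> B" using norm a by (simp add: A_def)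
      finally show "g \<otimes> a \<otimes> inv g \<in> A" using g(1) ac by (simp add: A_def)
    qed
    then show "s \<in> B" using g by (simp add: A_def)
  qed
  then have "N #> x = N" if "x \<in> carrier G" for x
    using \<pi>.hom_closed[OF that] one by simp
  then have "N = carrier G" using ker N.subset by blast
  then have "y \<in> N" if "y \<in> carrier G" for y using that by blast
  then have central: "k \<otimes> y = y \<otimes> k" if "k \<in> K" "y \<in> carrier G" for k y
    using that unfolding N_def by (metis (mono_tags, lifting) mem_Collect_eq)
  then have "k = \<one>" if "k \<in> K" for k
    using selfnormalizing_perfect_centerless[OF fin perf sn K.mem_carrier[OF that] central[OF that]] by blast
  then show ?thesis using K.one_closed by blast
qed

theorem theorem2p14:
  fixes G :: "('a, 'b) monoid_scheme"
  assumes "group G" and "finite (carrier G)" and "Y_n_group G"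
  shows "solvable G \<or> simple_group G"
proof (rule disjCI)
  assume not_simple: "\<not> simple_group G"
  interpret group G by fact
  note fin = assms(2)
  have sn: "g \<in> A"
    if A: "subgroup A G" "\<not> (\<forall>x\<in>A. \<forall>y\<in>A. x \<otimes>\<^bsub>G\<^esub> y = y \<otimes>\<^bsub>G\<^esub> x)" and g: "g \<in> carrier G"
      and conj: "\<And>a. a \<in> A \<Longrightarrow> g \<otimes>\<^bsub>G\<^esub> a \<otimes>\<^bsub>G\<^esub> inv\<^bsub>G\<^esub> g \<in> A" for A g
  proof -
    have "g \<in> normalizer G A" using normalizerI[OF fin A(1) g conj] .
    moreover have "normalizer G A = A" using assms(3) A unfolding Y_n_group_def by blast
    ultimately show ?thesis by simp
  qed
  \<comment> \<open>Every element of \<open>G\<close> normalizes \<open>K\<close>, so a non-abelian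
    \<open>K\<close> would be all of \<open>G\<close>.\<close>
  have normal_comm: "\<forall>x\<in>K. \<forall>y\<in>K. x \<otimes>\<^bsub>G\<^esub> y = y \<otimes>\<^bsub>G\<^esub> x" if K: "K \<lhd> G" "K \<noteq> carrier G" for K
  proof (rule ccontr)
    interpret K: normal K G by fact
    assume "\<not> ?thesis"
    then have "carrier G \<subseteq> K" using sn[OF K.subgroup_axioms] K.inv_op_closed2 by blast
    then show False using K.subset K(2) by blast
  qed
  show "solvable G"
  proof (rule ccontr)
    assume ns: "\<not> solvable G"
    \<comment> \<open>A proper derived subgroup would be abelian, making \<open>G\<close> soluble of
      derived length at most two.\<close>
    have perf: "derived G (carrier G) = carrier G"
    proof (rule ccontr)
      assume "derived G (carrier G) \<noteq> carrier G"
      then have "derived G (derived G (carrier G)) = {\<one>\<^bsub>G\<^esub>}"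
        using commutative_subset_derived[OF derived_is_subgroup] normal_comm[OF derived_self_is_normal]
        by blast
      then have "(derived G ^^ 2) (carrier G) = {\<one>\<^bsub>G\<^esub>}" by (simp add: numeral_2_eq_2)
      then show False
        using trivial_derived_seq_imp_solvable[OF subgroup_self] ns unfolding solvable_def by blast
    qed
    \<comment> \<open>\<open>simple_group\<close> demands order greater than one, so the trivial
      group, which is soluble, is excluded before a proper nontrivial normal subgroup is
      extracted.\<close>
    have "carrier G \<noteq> {\<one>\<^bsub>G\<^esub>}"
      using ns solvable_seq.unity[of G] unfolding solvable_def by auto
    then have "order G > 1"
      using fin order_one_triv_iff order_gt_0_iff_finite by (metis One_nat_def Suc_lessI)
    then obtain K where K: "K \<lhd> G" "K \<noteq> carrier G" "K \<noteq> {\<one>\<^bsub>G\<^esub>}"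
      using not_simple is_group unfolding simple_group_def simple_group_axioms_def by blast
    then show False
      using selfnormalizing_perfect_abelian_normal[OF fin perf sn K(1) normal_comm[OF K(1,2)]] by blast
  qed
qed

end
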